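(* Let $K$ be a compact nonempty set in $P(\mathbb Q)$ such that (i) $\mathrm{supp}(\mu)$ is locally compact for every $\mu\in K$, and $\mathrm{supp}(\mu)\cap\mathrm{supp}(\nu)$ is finite for all distinct $\mu,\nu\in K$; (ii) any nonempty (relatively) open set $V$ in $K$ contains a compact set $L$ such that, whenever $A\subseteq K$ is $\sigma$-uniformly tight, $L\setminus A$ contains a non-uniformly tight compact set. Then for any Borel function $f:K\to[0,1]$ there is a Borel set $B\subseteq K$ which is not $\sigma$-uniformly tight and such that $f|B$ is either constant or injective.
   Context: $\mathbb Q$ is the space of rationals with its usual topology. $P(\mathbb Q)$ is the space of probability Borel measures on $\mathbb Q$ with the weak topology (the topology of weak convergence, tested against bounded continuous functions). For $\mu\in P(\mathbb Q)$, $\mathrm{supp}(\mu)$ is the closure in $\mathbb Q$ of $\{q\in\mathbb Q:\mu(\{q\})>0\}$. A set $A\subseteq P(\mathbb Q)$ is uniformly tight if for every $\varepsilon>0$ there is a compact set $C\subseteq\mathbb Q$ with $\mu(\mathbb Q\setminus C)<\varepsilon$ for all $\mu\in A$; it is $\sigma$-uniformly tight if it is covered by countably many uniformly tight sets. *)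

theory Defs
  imports "HOL-Probability.Probability"
begin

text \<open>HOL provides no topology on the type \<^typ>\<open>rat\<close>; the space of rationals is rendered as
  the subspace of the real line formed by the rational reals.\<close>

abbreviation rationals_space :: "real topology" where
  "rationals_space \<equiv> top_of_set \<rat>"

definition borel_space :: "'a topology \<Rightarrow> 'a measure" where
  "borel_space X = sigma (topspace X) {U. openin X U}"

definition prob_measures :: "'a topology \<Rightarrow> 'a measure set" where
  "prob_measures X = {\<mu>. prob_space \<mu> \<and> sets \<mu> = sets (borel_space X)}"

text \<open>The coarsest topology on \<^term>\<open>prob_measures X\<close> for which integration against every
  bounded continuous real function is continuous.\<close>

definition weak_topology :: "'a topology \<Rightarrow> 'a measure topology" where
  "weak_topology X = topology_generated_by
     {{\<mu> \<in> prob_measures X. (\<integral>x. g x \<partial>\<mu>) \<in> U} |g U.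
        continuous_map X euclideanreal g \<and> bounded (g ` topspace X) \<and> open U}"

definition uniformly_tight :: "'a topology \<Rightarrow> 'a measure set \<Rightarrow> bool" where
  "uniformly_tight X A \<longleftrightarrow> A \<subseteq> prob_measures X \<and>
     (\<forall>\<epsilon>>0. \<exists>C. compactin X C \<and> (\<forall>\<mu>\<in>A. measure \<mu> (topspace X - C) < \<epsilon>))"

definition sigma_uniformly_tight :: "'a topology \<Rightarrow> 'a measure set \<Rightarrow> bool" where
  "sigma_uniformly_tight X A \<longleftrightarrow>
     (\<exists>\<T>. countable \<T> \<and> (\<forall>T\<in>\<T>. uniformly_tight X T) \<and> A \<subseteq> \<Union>\<T>)"

text \<open>Measures on the countable space of rationals are purely atomic, so the support is the
  closure of the set of atoms.\<close>

definition supp :: "real measure \<Rightarrow> real set" where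
  "supp \<mu> = rationals_space closure_of {q \<in> \<rat>. measure \<mu> {q} > 0}"

lemma space_borel_space [simp]: "space (borel_space X) = topspace X"
  by (simp add: borel_space_def space_measure_of_conv)

lemma sets_borel_space: "sets (borel_space X) = sigma_sets (topspace X) {U. openin X U}"
  unfolding borel_space_def by (rule sets_measure_of) (auto dest: openin_subset)

lemma sets_borel_space_top_of_set:
  "sets (borel_space (top_of_set S)) = sets (restrict_space borel S)"
proof -
  have "{(\<lambda>x. x) -` A \<inter> S |A. A \<in> sigma_sets UNIV {U. open U}} =
      sigma_sets S {(\<lambda>x. x) -` A \<inter> S |A. A \<in> {U. open U}}"
    by (rule sigma_sets_vimage_commute) simp
  moreover have "sets (restrict_space borel S) =
      {(\<lambda>x. x) -` A \<inter> S |A. A \<in> sigma_sets UNIV {U. open U}}"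
    by (auto simp: sets_restrict_space sets_borel)
  moreover have "{U. openin (top_of_set S) U} = {(\<lambda>x. x) -` A \<inter> S |A. A \<in> {U. open U}}"
    by (auto simp: openin_open)
  ultimately show ?thesis
    by (simp add: sets_borel_space)
qed

lemma topspace_weak_topology [simp]: "topspace (weak_topology X) = prob_measures X"
proof -
  have "prob_measures X \<in> {{\<mu> \<in> prob_measures X. (\<integral>x. g x \<partial>\<mu>) \<in> U} |g U.
        continuous_map X euclideanreal g \<and> bounded (g ` topspace X) \<and> open U}"
    by (rule CollectI, rule exI[of _ "\<lambda>_. 0"], rule exI[of _ UNIV]) (auto simp: image_constant_conv)
  then show ?thesis
    unfolding weak_topology_def by auto
qed

end

theory Submission
  imports Defs
begin

text \<open>Integrating countably many tent functions embeds \<open>K\<close> in a metric space, and the closure of a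
  tight set is tight. If some fibre of \<open>f\<close> is not \<open>\<sigma>\<close>-tight, it is the required set. Otherwise \<open>f\<close> is
  continuous on a dense \<open>G\<^sub>\<delta>\<close> set \<open>G\<close>, and every nonempty open set \<open>V\<close> contains a non-tight set \<open>D\<close>
  together with points of \<open>G \<inter> V\<close> that accumulate at all of \<open>D\<close> while their \<open>f\<close>-values are distinct
  and isolated. Small balls around these points have disjoint \<open>f\<close>-images, and a closed tight set
  misses one of them, as otherwise it would contain \<open>D\<close>. Iterating gives a tree of open sets whose
  branches form a Borel set on which \<open>f\<close> is injective; given countably many closed tight sets, some
  branch leaves them all.\<close>

section \<open>Baire category on a compact set\<close>

lemma compact_Baire:
  fixes M :: "'a::metric_space set" and W :: "nat \<Rightarrow> 'a set"
  assumes "compact M" and "\<And>n. open (W n)" and dense: "\<And>n. M \<subseteq> closure (M \<inter> W n)"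
  shows "M \<subseteq> closure (M \<inter> (\<Inter>n. W n))"
proof -
  let ?X = "top_of_set M"
  have "?X closure_of \<Inter>(range (\<lambda>n. M \<inter> W n)) = topspace ?X"
  proof (rule Baire_category)
    show "completely_metrizable_space ?X \<or> locally_compact_space ?X \<and> regular_space ?X"
      using assms(1) by (simp add: compact_imp_locally_compact_space compact_space_subtopology
          regular_space_euclidean regular_space_subtopology)
    show "openin ?X T \<and> ?X closure_of T = topspace ?X" if "T \<in> range (\<lambda>n. M \<inter> W n)" for T
      using that assms(2) dense
      by (auto simp: closure_of_subtopology Int_absorb1 intro!: openin_open_Int subsetD[OF dense])
  qed auto
  then show ?thesis
    by (auto simp: closure_of_subtopology)
qed

lemma dense_openI:
  assumes "\<And>V. open V \<Longrightarrow> V \<inter> M \<noteq> {} \<Longrightarrow> V \<inter> S \<noteq> {}"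
  shows "M \<subseteq> closure S"
proof
  fix x assume "x \<in> M"
  then show "x \<in> closure S"
    using assms[of "- closure S"] closure_subset[of S] by (auto simp: open_Compl)
qed

lemma dense_openD:
  "M \<subseteq> closure S \<Longrightarrow> open V \<Longrightarrow> V \<inter> M \<noteq> {} \<Longrightarrow> V \<inter> S \<noteq> {}"
  using open_Int_closure_eq_empty[of V S] by blast

text \<open>Encodes a comeagre subset of \<open>M\<close>, namely
  \<open>M \<inter> \<Inter>\<W>\<close>. The members are open in the whole space and only their
  traces on \<open>M\<close> must be dense; the empty family stands for \<open>M\<close>
  itself.\<close>

definition dense_open_family :: "'a::topological_space set \<Rightarrow> 'a set set \<Rightarrow> bool" where
  "dense_open_family M \<W> \<longleftrightarrow> countable \<W> \<and> (\<forall>U\<in>\<W>. open U \<and> M \<subseteq> closure (M \<inter> U))"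

text \<open>Induction over the generated \<open>\<sigma>\<close>-algebra: agreement with an open set
  modulo a meagre subset of \<open>M\<close> survives complements, at the cost of one nowhere dense
  boundary, and countable unions, by merging the families.\<close>

lemma borel_Baire_property:
  assumes "S \<in> sets borel"
  shows "\<exists>U \<W>. open U \<and> dense_open_family M \<W> \<and> M \<inter> S \<inter> \<Inter>\<W> = M \<inter> U \<inter> \<Inter>\<W>"
proof -
  from assms have "S \<in> sigma_sets UNIV {S. open S}"
    by (simp add: sets_borel)
  then show ?thesis
  proof induction
    case (Basic S)
    then show ?case
      by (intro exI[of _ S] exI[of _ "{}"]) (auto simp: dense_open_family_def)
  next
    case Empty
    show ?case
      by (intro exI[of _ "{}"] exI[of _ "{}"]) (auto simp: dense_open_family_def)
  next
    case (Compl S)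
    then obtain U \<W> where U: "open U" "dense_open_family M \<W>" "M \<inter> S \<inter> \<Inter>\<W> = M \<inter> U \<inter> \<Inter>\<W>"
      by blast
    \<comment> \<open>The exterior of \<open>M \<inter> U\<close>. On \<open>M\<close> it differs
      from the complement of \<open>U\<close> only outside the dense open set
      \<open>U \<union> U'\<close>.\<close>
    define U' where "U' = - closure (M \<inter> U)"
    have "M \<subseteq> closure (M \<inter> (U \<union> U'))"
    proof
      fix x assume "x \<in> M"
      then show "x \<in> closure (M \<inter> (U \<union> U'))"
        using closure_subset[of "M \<inter> (U \<union> U')"] closure_mono[of "M \<inter> U" "M \<inter> (U \<union> U')"]
        unfolding U'_def by blast
    qed
    moreover have "M \<inter> U \<inter> U' = {}"
      using closure_subset[of "M \<inter> U"] by (auto simp: U'_def)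
    moreover have "open U'"
      by (simp add: U'_def open_Compl)
    ultimately show ?case
      using U by (intro exI[of _ U'] exI[of _ "insert (U \<union> U') \<W>"])
        (auto simp: dense_open_family_def)
  next
    case (Union S)
    then have "\<forall>i. \<exists>U \<W>. open U \<and> dense_open_family M \<W> \<and> M \<inter> S i \<inter> \<Inter>\<W> = M \<inter> U \<inter> \<Inter>\<W>"
      by blast
    then obtain U \<W> where "\<And>i. open (U i)" "\<And>i. dense_open_family M (\<W> i)"
      and eq: "\<And>i. M \<inter> S i \<inter> \<Inter>(\<W> i) = M \<inter> U i \<inter> \<Inter>(\<W> i)"
      by metis
    moreover have "M \<inter> (\<Union>i. S i) \<inter> \<Inter>(\<Union>i. \<W> i) = M \<inter> (\<Union>i. U i) \<inter> \<Inter>(\<Union>i. \<W> i)"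
    proof -
      define X where "X = \<Inter>(\<Union>i. \<W> i)"
      have "X \<subseteq> \<Inter>(\<W> i)" for i
        by (auto simp: X_def)
      then have "M \<inter> S i \<inter> X = M \<inter> U i \<inter> X" for i
        using eq[of i] by blast
      then show ?thesis
        unfolding X_def[symmetric] by (auto simp: set_eq_iff)
    qed
    ultimately show ?case
      by (intro exI[of _ "\<Union>i. U i"] exI[of _ "\<Union>i. \<W> i"]) (auto simp: dense_open_family_def)
  qed
qed

text \<open>Preimages of the members of a countable base agree with open sets off meagre sets. Once
  all these exceptional sets are discarded, preimages of open sets are relatively open.\<close>

lemma borel_measurable_continuous_on_comeagre:
  fixes f :: "'a::topological_space \<Rightarrow> 'b::second_countable_topology"
  assumes M: "closed M" and f: "f \<in> borel_measurable (restrict_space borel M)"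
  obtains W :: "nat \<Rightarrow> 'a set"
  where "\<And>n. open (W n)" "\<And>n. M \<subseteq> closure (M \<inter> W n)" "continuous_on (M \<inter> (\<Inter>n. W n)) f"
proof -
  obtain \<B> :: "'b set set" where \<B>: "countable \<B>" "topological_basis \<B>"
    using ex_countable_basis by blast
  have "\<exists>U \<W>. open U \<and> dense_open_family M \<W> \<and> M \<inter> f -` J \<inter> \<Inter>\<W> = M \<inter> U \<inter> \<Inter>\<W>"
    if "J \<in> \<B>" for J
  proof -
    have "f -` J \<inter> M \<in> sets borel"
      using measurable_sets[OF f, of J] topological_basis_open[OF \<B>(2) that] M
      by (auto simp: sets_restrict_space_iff space_restrict_space)
    from borel_Baire_property[OF this, of M] show ?thesis
      by (simp add: Int_commute Int_left_commute)
  qed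
  then obtain U \<W> where U: "\<And>J. J \<in> \<B> \<Longrightarrow> open (U J)"
    and \<W>: "\<And>J. J \<in> \<B> \<Longrightarrow> dense_open_family M (\<W> J)"
    and eq: "\<And>J. J \<in> \<B> \<Longrightarrow> M \<inter> f -` J \<inter> \<Inter>(\<W> J) = M \<inter> U J \<inter> \<Inter>(\<W> J)"
    by metis
  \<comment> \<open>\<open>UNIV\<close> keeps the family nonempty, so that
    \<open>from_nat_into\<close> enumerates it as a sequence.\<close>
  define \<V> where "\<V> = insert UNIV (\<Union>(\<W> ` \<B>))"
  have \<V>: "countable \<V>" "\<V> \<noteq> {}" "\<And>V. V \<in> \<V> \<Longrightarrow> open V \<and> M \<subseteq> closure (M \<inter> V)"
    using \<W> \<B>(1) closure_subset[of M] by (auto simp: \<V>_def dense_open_family_def)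
  define W where "W = from_nat_into \<V>"
  have range_W: "range W = \<V>"
    by (simp add: W_def \<V> range_from_nat_into)
  have cont: "continuous_on (M \<inter> \<Inter>\<V>) f"
    unfolding continuous_on_open_invariant
  proof (intro allI impI)
    fix B :: "'b set" assume "open B"
    then obtain \<J> where \<J>: "\<J> \<subseteq> \<B>" "\<Union>\<J> = B"
      using \<B>(2) unfolding topological_basis_def by blast
    have "open (\<Union>(U ` \<J>))"
      using U \<J>(1) by blast
    moreover have "\<Union>(U ` \<J>) \<inter> (M \<inter> \<Inter>\<V>) = f -` B \<inter> (M \<inter> \<Inter>\<V>)"
    proof -
      have "U J \<inter> (M \<inter> \<Inter>\<V>) = f -` J \<inter> (M \<inter> \<Inter>\<V>)" if "J \<in> \<J>" for J
      proof -
        have "\<Inter>\<V> \<subseteq> \<Inter>(\<W> J)"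
          using that \<J>(1) by (auto simp: \<V>_def)
        then show ?thesis
          using eq[of J] that \<J>(1) by blast
      qed
      then show ?thesis
        using \<J>(2) by blast
    qed
    ultimately show "\<exists>A. open A \<and> A \<inter> (M \<inter> \<Inter>\<V>) = f -` B \<inter> (M \<inter> \<Inter>\<V>)"
      by blast
  qed
  show ?thesis
  proof (rule that)
    show "open (W n)" "M \<subseteq> closure (M \<inter> W n)" for n
      using \<V>(3) range_W by blast+
    show "continuous_on (M \<inter> (\<Inter>n. W n)) f"
      using cont range_W by simp
  qed
qed

section \<open>Tightness on a compact metric space\<close>

text \<open>Keeps of uniform tightness only what the construction uses: a hereditary family, stable
  under closure, with hypothesis (ii) restated for sequences of tight sets. \<open>M\<close> is to
  be a metrizable copy of \<open>K\<close>.\<close>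

locale rich_tightness =
  fixes M :: "'a::{metric_space,second_countable_topology} set" and tight :: "'a set \<Rightarrow> bool"
  assumes compact_M: "compact M"
    and tight_empty: "tight {}"
    and tight_subset: "\<And>S T. tight T \<Longrightarrow> S \<subseteq> T \<Longrightarrow> tight S"
    and tight_closure: "\<And>T. tight T \<Longrightarrow> tight (closure T)"
    and rich: "\<And>V. open V \<Longrightarrow> V \<inter> M \<noteq> {} \<Longrightarrow>
      \<exists>L\<subseteq>V \<inter> M. compact L \<and> (\<forall>T. (\<forall>n::nat. tight (T n)) \<longrightarrow>
        (\<exists>C\<subseteq>L - (\<Union>n. T n). compact C \<and> \<not> tight C))"
begin

definition sigma_tight :: "'a set \<Rightarrow> bool" where
  "sigma_tight S \<longleftrightarrow> (\<exists>T::nat \<Rightarrow> 'a set. (\<forall>n. tight (T n)) \<and> S \<subseteq> (\<Union>n. T n))"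

lemma sigma_tight_subset: "sigma_tight T \<Longrightarrow> S \<subseteq> T \<Longrightarrow> sigma_tight S"
  unfolding sigma_tight_def by blast

text \<open>Closures of tight sets are tight, so a countable cover can be taken closed, as both the
  Baire argument and the tree require.\<close>

lemma sigma_tight_closedE:
  assumes "sigma_tight S"
  obtains T :: "nat \<Rightarrow> 'a set"
  where "\<And>n. closed (T n)" "\<And>n. tight (T n)" "S \<subseteq> (\<Union>n. T n)"
proof -
  obtain T :: "nat \<Rightarrow> 'a set" where "\<And>n. tight (T n)" "S \<subseteq> (\<Union>n. T n)"
    using assms unfolding sigma_tight_def by blast
  moreover have "(\<Union>n. T n) \<subseteq> (\<Union>n. closure (T n))"
    using closure_subset by blast
  ultimately show thesis
    by (intro that[of "\<lambda>n. closure (T n)"]) (auto intro: tight_closure)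
qed

text \<open>Removing only empty sets from the \<open>L\<close> of \<open>rich\<close> already leaves
  a non-tight subset, which a tight \<open>V \<inter> M\<close> could not contain.\<close>

lemma open_not_tight:
  assumes "open V" "V \<inter> M \<noteq> {}" shows "\<not> tight (V \<inter> M)"
proof
  assume tight: "tight (V \<inter> M)"
  obtain L where L: "L \<subseteq> V \<inter> M"
    "\<And>T. (\<forall>n::nat. tight (T n)) \<Longrightarrow> \<exists>C\<subseteq>L - (\<Union>n. T n). compact C \<and> \<not> tight C"
    using rich[OF assms] by metis
  obtain C where "C \<subseteq> L" "\<not> tight C"
    using L(2)[of "\<lambda>_. {}"] tight_empty by auto
  then show False
    using tight_subset[OF tight] L(1) by blast
qed

text \<open>By \<open>open_not_tight\<close> a closed tight set has dense complement in
  \<open>M\<close>, so Baire category provides a point of \<open>V\<close> in all \<open>W n\<close>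
  and outside a given closed tight cover.\<close>

lemma comeagre_not_sigma_tight:
  assumes W: "\<And>n::nat. open (W n)" "\<And>n. M \<subseteq> closure (M \<inter> W n)"
    and V: "open V" "V \<inter> M \<noteq> {}"
  shows "\<not> sigma_tight (V \<inter> (M \<inter> (\<Inter>n. W n)))"
proof
  assume "sigma_tight (V \<inter> (M \<inter> (\<Inter>n. W n)))"
  then obtain T :: "nat \<Rightarrow> 'a set" where T: "\<And>n. closed (T n)" "\<And>n. tight (T n)"
    "V \<inter> (M \<inter> (\<Inter>n. W n)) \<subseteq> (\<Union>n. T n)"
    by (erule sigma_tight_closedE)
  \<comment> \<open>Interleaves the two sequences, so that one use of Baire category handles
    both.\<close>
  define W' where "W' n = (if even n then W (n div 2) else - T (n div 2))" for n
  have "M \<subseteq> closure (M \<inter> (\<Inter>n. W' n))"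
  proof (rule compact_Baire[OF compact_M])
    show "open (W' n)" for n
      using W(1) T(1) by (simp add: W'_def open_Compl)
    have "M \<subseteq> closure (M \<inter> - T n)" for n
    proof (rule dense_openI)
      fix U assume "open U" "U \<inter> M \<noteq> {}"
      then show "U \<inter> (M \<inter> - T n) \<noteq> {}"
        using open_not_tight[of U] tight_subset[OF T(2)[of n], of "U \<inter> M"] by blast
    qed
    then show "M \<subseteq> closure (M \<inter> W' n)" for n
      using W(2) by (simp add: W'_def)
  qed
  from dense_openD[OF this V] obtain x where x: "x \<in> V" "x \<in> M" "\<And>n. x \<in> W' n"
    by blast
  have "x \<in> W n" "x \<notin> T n" for n
    using x(3)[of "2 * n"] x(3)[of "2 * n + 1"] by (auto simp: W'_def)
  then show False
    using x T(3) by blast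
qed


section \<open>Accumulating points with isolated values\<close>

text \<open>\<open>G\<close> stands for a comeagre set on which \<open>f\<close> is continuous;
  \<open>fibre\<close> is the case in which no fibre can serve as the required set.\<close>

context
  fixes f :: "'a \<Rightarrow> real" and G :: "'a set" and a b :: real
  assumes G: "G \<subseteq> M" "M \<subseteq> closure G" "\<And>V. open V \<Longrightarrow> V \<inter> M \<noteq> {} \<Longrightarrow> \<not> sigma_tight (V \<inter> G)"
    and f: "continuous_on G f" "f ` M \<subseteq> {a..b}"
    and fibre: "\<And>t. sigma_tight {x\<in>M. f x = t}"
begin

text \<open>\<open>Y\<close> consists of limit values of \<open>f\<close> at points of
  \<open>D\<close>. Values off \<open>Y\<close> can be found ever closer to \<open>Y\<close>, so the
  distance to \<open>Y\<close> can later tell the values of a sequence of such points apart.\<close>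

lemma accumulating_points:
  assumes V: "open V" "V \<inter> M \<noteq> {}"
  obtains D Y where "D \<subseteq> V \<inter> M" "\<not> tight D"
    "\<And>c e. c \<in> D \<Longrightarrow> e > 0 \<Longrightarrow> \<exists>p\<in>G \<inter> V. dist p c < e \<and> 0 < infdist (f p) Y \<and> infdist (f p) Y < e"
proof -
  obtain L where L: "L \<subseteq> V \<inter> M" "compact L" and rich_L:
    "\<And>T. (\<forall>n::nat. tight (T n)) \<Longrightarrow> \<exists>C\<subseteq>L - (\<Union>n. T n). compact C \<and> \<not> tight C"
    using rich[OF V] by metis
  \<comment> \<open>\<open>\<Gamma>\<close> is compact; its sections over \<open>L\<close> are either all tight, and then removing countably many of
    them from \<open>L\<close> leaves a non-tight compact set, or one of them serves as \<open>D\<close>.\<close>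
  define \<Gamma> where "\<Gamma> = closure ((\<lambda>x. (x, f x)) ` G)"
  have graph_sub: "(x, f x) \<in> \<Gamma>" if "x \<in> G" for x
    unfolding \<Gamma>_def by (rule subsetD[OF closure_subset]) (use that in simp)
  have "closed \<Gamma>"
    by (simp add: \<Gamma>_def)
  have "\<Gamma> \<subseteq> M \<times> {a..b}"
    unfolding \<Gamma>_def using G(1) f(2) compact_M
    by (intro closure_minimal closed_Times compact_imp_closed) auto
  then have "compact \<Gamma>"
    using \<open>closed \<Gamma>\<close> compact_M compact_Times[of M "{a..b}"]
    by (metis compact_Icc compact_Int_closed inf.absorb_iff2)
  have near: "\<exists>g\<in>G. dist g c < e \<and> dist (f g) y < e" 
    if cy: "(c, y) \<in> closure ((\<lambda>x. (x, f x)) ` H)" and "e > 0" "H \<subseteq> G" for c y e H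
  proof -
    obtain g where "g \<in> H" "dist (g, f g) (c, y) < e"
      using cy \<open>e > 0\<close> unfolding closure_approachable by auto
    then show ?thesis
      using \<open>H \<subseteq> G\<close> dist_fst_le[of "(g, f g)" "(c, y)"] dist_snd_le[of "(g, f g)" "(c, y)"]
      by (intro bexI[of _ g]) auto
  qed
  show thesis
  proof (cases "\<exists>t. \<not> tight {c\<in>L. (c, t) \<in> \<Gamma>}")
    case True
    then obtain t where t: "\<not> tight {c\<in>L. (c, t) \<in> \<Gamma>}"
      by blast
    show thesis
    proof (rule that[OF _ t, of "{t}"])
      fix c e assume c: "c \<in> {c\<in>L. (c, t) \<in> \<Gamma>}" and "e > (0::real)"
      have "c \<in> V" "open (V \<inter> ball c e)" "c \<in> V \<inter> ball c e"
        using c L(1) V(1) \<open>e > 0\<close> by auto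
      then obtain d where d: "d > 0" "ball c d \<subseteq> V \<inter> ball c e"
        using openE by blast
      obtain g where g: "g \<in> G" "dist g c < min d e" "dist (f g) t < min d e"
        using near[of c t G "min d e"] c \<open>d > 0\<close> \<open>e > 0\<close> unfolding \<Gamma>_def by auto
      obtain r where r: "r > 0" "\<And>x. x \<in> G \<Longrightarrow> dist x g < r \<Longrightarrow> dist (f x) (f g) < e - dist (f g) t"
        using f(1) g(1,3) unfolding continuous_on_iff by (metis diff_gt_0_iff_gt min_less_iff_conj)
      \<comment> \<open>On \<open>U \<inter> G\<close> the values stay within \<open>e\<close> of
        \<open>t\<close>, but the \<open>\<sigma>\<close>-tight fibre over \<open>t\<close> cannot
        contain this set, so some \<open>p\<close> in it has another value.\<close>
      define U where "U = ball c d \<inter> ball g r"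
      have "g \<in> U" "open U"
        using g r by (auto simp: U_def dist_commute)
      then have "\<not> U \<inter> G \<subseteq> {x\<in>M. f x = t}"
        using G(1) G(3)[of U] g(1) sigma_tight_subset[OF fibre[of t], of "U \<inter> G"] by blast
      then obtain p where p: "p \<in> U" "p \<in> G" "f p \<noteq> t"
        using G(1) by blast
      then have "p \<in> V" "dist p c < e"
        using d(2) by (auto simp: U_def dist_commute)
      moreover have "dist (f p) t < e"
        using r(2)[of p] p dist_triangle[of "f p" t "f g"] by (auto simp: U_def dist_commute)
      ultimately show "\<exists>p\<in>G \<inter> V. dist p c < e \<and> 0 < infdist (f p) {t} \<and> infdist (f p) {t} < e"
        using p by auto
    qed (use L in auto)
  next
    case False
    \<comment> \<open>Density is asked in the graph, not just in \<open>G\<close>: points of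
      \<open>Q\<close> then approximate each limit value together with its base point, while only
      countably many values have to be kept out of \<open>Y\<close>.\<close>
    obtain P where P: "countable P" "P \<subseteq> (\<lambda>x. (x, f x)) ` G"
      "(\<lambda>x. (x, f x)) ` G \<subseteq> closure P"
      using separable[of "(\<lambda>x. (x, f x)) ` G"] by blast
    then obtain Q where Q: "countable Q" "Q \<subseteq> G" "P = (\<lambda>x. (x, f x)) ` Q"
      using countable_subset_image[of P "\<lambda>x. (x, f x)" G] by blast
    have \<Gamma>_Q: "\<Gamma> = closure ((\<lambda>x. (x, f x)) ` Q)"
      unfolding \<Gamma>_def Q(3)[symmetric]
      using closure_minimal[OF P(3) closed_closure] closure_mono[OF P(2)] by (rule subset_antisym)
    have "G \<noteq> {}"
      using G(2) V(2) by auto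
    then have "Q \<noteq> {}"
      using P Q by auto
    define q where "q = from_nat_into Q"
    have q: "range q = Q"
      using Q(1) \<open>Q \<noteq> {}\<close> by (simp add: q_def range_from_nat_into)
    obtain C where C: "C \<subseteq> L - (\<Union>n. {c\<in>L. (c, f (q n)) \<in> \<Gamma>})" "compact C" "\<not> tight C"
      using rich_L[of "\<lambda>n. {c\<in>L. (c, f (q n)) \<in> \<Gamma>}"] False by blast
    \<comment> \<open>Closed as a projection of a compact set, and free of the values of
      \<open>f\<close> on \<open>Q\<close>, since \<open>C\<close> avoids their sections.\<close>
    define Y where "Y = snd ` (\<Gamma> \<inter> C \<times> UNIV)"
    have "compact (\<Gamma> \<inter> C \<times> UNIV)"
      using \<open>compact \<Gamma>\<close> C(2) by (intro compact_Int_closed closed_Times) (auto simp: compact_imp_closed)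
    then have "closed Y"
      unfolding Y_def by (intro compact_imp_closed compact_continuous_image continuous_intros)
    have "f x \<notin> Y" if "x \<in> Q" for x
      using C(1) that q unfolding Y_def by force
    \<comment> \<open>Every point of \<open>M\<close> has a limit value: the projection is closed
      and contains the dense set \<open>G\<close>.\<close>
    have "M \<subseteq> fst ` \<Gamma>"
    proof -
      have "closed (fst ` \<Gamma>)"
        using \<open>compact \<Gamma>\<close> by (intro compact_imp_closed compact_continuous_image continuous_intros)
      moreover have "G \<subseteq> fst ` \<Gamma>"
        using graph_sub by force
      ultimately show ?thesis
        using G(2) closure_minimal[of G] by blast
    qed
    show thesis
    proof (rule that[OF _ C(3)])
      show "C \<subseteq> V \<inter> M"
        using C(1) L(1) by blast
      fix c e assume c: "c \<in> C" and "e > (0::real)"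
      then have "c \<in> V" "c \<in> M"
        using C(1) L(1) by blast+
      then obtain d where d: "d > 0" "ball c d \<subseteq> V"
        using V(1) openE by blast
      obtain y where y: "(c, y) \<in> \<Gamma>"
        using \<open>M \<subseteq> fst ` \<Gamma>\<close> \<open>c \<in> M\<close> by force
      then have "y \<in> Y"
        using c by (force simp: Y_def)
      obtain p where p: "p \<in> Q" "dist (p, f p) (c, y) < min d e"
        using y d(1) \<open>e > 0\<close> unfolding \<Gamma>_Q closure_approachable
        by (smt (verit) imageE)
      have "dist p c < min d e" "dist (f p) y < e"
        using p(2) dist_fst_le[of "(p, f p)" "(c, y)"] dist_snd_le[of "(p, f p)" "(c, y)"] by auto
      then show "\<exists>p\<in>G \<inter> V. dist p c < e \<and> 0 < infdist (f p) Y \<and> infdist (f p) Y < e"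
        using p(1) Q(2) d(2) infdist_le[OF \<open>y \<in> Y\<close>, of "f p"] \<open>y \<in> Y\<close>
          infdist_pos_not_in_closed[OF \<open>closed Y\<close> _ \<open>\<And>x. x \<in> Q \<Longrightarrow> f x \<notin> Y\<close>, of p]
        by (intro bexI[of _ p]) (auto simp: dist_commute)
    qed
  qed
qed

text \<open>The sets are balls around points that follow an enumeration of a dense subset of
  \<open>D\<close> with vanishing error, so a closed set meeting all of them contains
  \<open>D\<close> and is not tight. Their images are separated by the distances of the values to
  \<open>Y\<close>.\<close>

lemma splitting:
  assumes V: "open V" "V \<inter> M \<noteq> {}" and "e > 0"
  obtains U :: "nat \<Rightarrow> 'a set"
  where "\<And>i. open (U i)" "\<And>i. U i \<inter> M \<noteq> {}" "\<And>i. closure (U i) \<subseteq> V"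
    "\<And>i x y. x \<in> U i \<Longrightarrow> y \<in> U i \<Longrightarrow> dist x y < e"
    "\<And>i j x y. i \<noteq> j \<Longrightarrow> x \<in> U i \<inter> G \<Longrightarrow> y \<in> U j \<inter> G \<Longrightarrow> f x \<noteq> f y"
    "\<And>T. closed T \<Longrightarrow> tight T \<Longrightarrow> \<exists>i. U i \<inter> T = {}"
proof -
  obtain D Y where D: "D \<subseteq> V \<inter> M" "\<not> tight D"
    and acc: "\<And>c e. c \<in> D \<Longrightarrow> e > 0 \<Longrightarrow>
      \<exists>p\<in>G \<inter> V. dist p c < e \<and> 0 < infdist (f p) Y \<and> infdist (f p) Y < e"
    using accumulating_points[OF V] by metis
  define h where "h x = infdist (f x) Y" for x
  obtain E where E: "countable E" "E \<subseteq> D" "D \<subseteq> closure E"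
    using separable by blast
  have "D \<noteq> {}"
    using D(2) tight_empty by auto
  then have "E \<noteq> {}"
    using E(3) by auto
  \<comment> \<open>\<open>c\<close> lists each point of \<open>E\<close> infinitely often.\<close>
  define c where "c i = from_nat_into E (fst (prod_decode i))" for i
  have c: "c i \<in> D" for i
    using E(2) \<open>E \<noteq> {}\<close> from_nat_into[of E] by (auto simp: c_def)
  have c_recurs: "\<exists>i\<ge>m. c i = x" if "x \<in> E" for x m
    using from_nat_into_surj[OF E(1) that] le_prod_encode_2[of m]
    by (metis c_def fst_conv prod_encode_inverse)
  \<comment> \<open>Positivity of \<open>h\<close> at one point is what lets \<open>acc\<close>
    supply the next point with less than half that value.\<close>
  have "\<exists>p. \<forall>i. (p i \<in> G \<inter> V \<and> dist (p i) (c i) < (1/2)^i \<and> 0 < h (p i)) \<and> h (p (Suc i)) < h (p i) / 2"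
  proof (rule dependent_nat_choice)
    show "\<exists>x. x \<in> G \<inter> V \<and> dist x (c 0) < (1/2)^0 \<and> 0 < h x"
      using acc[OF c[of 0], of 1] by (auto simp: h_def)
    fix x i assume "x \<in> G \<inter> V \<and> dist x (c i) < (1/2)^i \<and> 0 < h x"
    then show "\<exists>y. (y \<in> G \<inter> V \<and> dist y (c (Suc i)) < (1/2)^Suc i \<and> 0 < h y) \<and> h y < h x / 2"
      using acc[OF c[of "Suc i"], of "min ((1/2)^Suc i) (h x / 2)"] by (auto simp: h_def)
  qed
  then obtain p where p: "\<And>i. p i \<in> G" "\<And>i. p i \<in> V" "\<And>i. dist (p i) (c i) < (1/2)^i"
    "\<And>i. 0 < h (p i)" "\<And>i. h (p (Suc i)) < h (p i) / 2"
    by blast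
  \<comment> \<open>The values of \<open>h\<close> at the points \<open>p i\<close> decrease so fast that small perturbations keep them apart.\<close>
  have h_less: "h (p j) < h (p i) / 2" if "i < j" for i j
    using that
  proof (induction j)
    case (Suc j)
    then show ?case
      using p(4)[of j] p(5)[of j] by (cases "i = j") auto
  qed simp
  have "\<exists>r>0. r < e / 2 \<and> r < (1/2)^i \<and> cball (p i) r \<subseteq> V \<and>
      (\<forall>x\<in>G. dist x (p i) < r \<longrightarrow> dist (f x) (f (p i)) < h (p i) / 4)" for i
  proof -
    obtain r1 where r1: "r1 > 0" "cball (p i) r1 \<subseteq> V"
      using V(1) p(2) open_contains_cball by blast
    have "h (p i) / 4 > 0"
      using p(4)[of i] by simp
    then obtain r2 where r2: "r2 > 0" "\<forall>x\<in>G. dist x (p i) < r2 \<longrightarrow> dist (f x) (f (p i)) < h (p i) / 4"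
      using f(1) p(1)[of i] unfolding continuous_on_iff by meson
    \<comment> \<open>\<open>e / 4\<close> and the extra factor 1/2 make the first two bounds
      strict.\<close>
    define r where "r = min (min (e / 4) ((1/2)^i / 2)) (min r1 r2)"
    have "r > 0" "r < e / 2" "r < (1/2)^i" "r \<le> r1" "r \<le> r2"
      using \<open>e > 0\<close> r1 r2 by (auto simp: r_def min_def)
    then show ?thesis
      using r1 r2 subset_cball[OF \<open>r \<le> r1\<close>, of "p i"] by (intro exI[of _ r]) auto
  qed
  then obtain r where r: "\<And>i. r i > 0" "\<And>i. r i < e / 2" "\<And>i. r i < (1/2)^i"
    "\<And>i. cball (p i) (r i) \<subseteq> V"
    "\<And>i x. x \<in> G \<Longrightarrow> dist x (p i) < r i \<Longrightarrow> dist (f x) (f (p i)) < h (p i) / 4"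
    by metis
  have h_near: "\<bar>h x - h (p i)\<bar> < h (p i) / 4" if "x \<in> ball (p i) (r i) \<inter> G" for x i
    using r(5)[of x i] that infdist_triangle_abs[of "f x" Y "f (p i)"]
    by (auto simp: h_def dist_commute)
  have sep: "f x \<noteq> f y"
    if "i < j" and x: "x \<in> ball (p i) (r i) \<inter> G" and y: "y \<in> ball (p j) (r j) \<inter> G" for i j x y
  proof
    assume "f x = f y"
    then have "h x = h y"
      by (simp add: h_def)
    \<comment> \<open>Here \<open>h x > 3/4 * h (p i)\<close>, whereas
      \<open>h y < 5/4 * h (p j) < 5/8 * h (p i)\<close>.\<close>
    then show False
      using h_near[OF x] h_near[OF y] h_less[OF \<open>i < j\<close>] p(4)[of i] p(4)[of j] by linarith
  qed
  show thesis
  proof (rule that[of "\<lambda>i. ball (p i) (r i)"])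
    show "ball (p i) (r i) \<inter> M \<noteq> {}" for i
      using p(1)[of i] r(1)[of i] G(1) centre_in_ball[of "p i" "r i"] by blast
    show "closure (ball (p i) (r i)) \<subseteq> V" for i
      using r(4)[of i] closure_minimal[OF ball_subset_cball closed_cball, of "p i" "r i"] by blast
    show "dist x y < e" if "x \<in> ball (p i) (r i)" "y \<in> ball (p i) (r i)" for i x y
      using that r(2)[of i] dist_triangle2[of x y "p i"] by (auto simp: dist_commute)
    show "f x \<noteq> f y" if "i \<noteq> j" "x \<in> ball (p i) (r i) \<inter> G" "y \<in> ball (p j) (r j) \<inter> G" for i j x y
      using sep[of i j x y] sep[of j i y x] that by (cases "i < j") auto
    fix T assume T: "closed T" "tight T"
    show "\<exists>i. ball (p i) (r i) \<inter> T = {}"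
    proof (rule ccontr)
      assume "\<nexists>i. ball (p i) (r i) \<inter> T = {}"
      then have "\<And>i. \<exists>q. q \<in> T \<and> dist q (p i) < r i"
        by (auto simp: dist_commute disjoint_iff)
      then obtain q where q: "\<And>i. q i \<in> T" "\<And>i. dist (q i) (p i) < r i"
        by metis
      have "E \<subseteq> closure T"
      proof (clarsimp simp: closure_approachable)
        fix x and d :: real assume "x \<in> E" "d > 0"
        \<comment> \<open>\<open>q i\<close> is within \<open>(1/2)^i\<close> of \<open>p i\<close>,
          and \<open>p i\<close> is equally close to \<open>c i = x\<close>; for
          \<open>i \<ge> m\<close> the two errors add up to less than \<open>d\<close>.\<close>
        obtain m where m: "(1/2::real)^m < d / 2"
          using \<open>d > 0\<close> real_arch_pow_inv[of "d/2" "1/2"] by auto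
        obtain i where i: "i \<ge> m" "c i = x"
          using c_recurs[OF \<open>x \<in> E\<close>] by blast
        have "(1/2::real)^i \<le> (1/2)^m"
          using i(1) by (intro power_decreasing) auto
        then have "dist (q i) x < d"
          using q(2)[of i] r(3)[of i] p(3)[of i, unfolded i(2)] m dist_triangle[of "q i" x "p i"] by linarith
        then show "\<exists>y\<in>T. dist y x < d"
          using q(1) by blast
      qed
      then have "D \<subseteq> T"
        using E(3) T(1) closure_minimal[of E T] by auto
      then show False
        using D(2) T(2) tight_subset by blast
    qed
  qed auto
qed

section \<open>The tree of open sets and its branches\<close>

text \<open>Nodes are indexed by finite lists. Cutting down to \<open>W n\<close> at level
  \<open>n\<close> keeps branch points in \<open>G\<close>; separated siblings and shrinking
  diameters give injectivity; choosing at each level a child that misses the next closed tight set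
  gives a branch outside a given cover.\<close>

lemma injective_set:
  assumes W: "\<And>n::nat. open (W n)" and G_eq: "G = M \<inter> (\<Inter>n. W n)" and "M \<noteq> {}"
  obtains B where "B \<in> sets borel" "B \<subseteq> M" "\<not> sigma_tight B" "inj_on f B"
proof -
  define splits where "splits V n U \<longleftrightarrow>
      (\<forall>i. open (U i) \<and> U i \<inter> M \<noteq> {} \<and> closure (U i) \<subseteq> V \<and>
        (\<forall>x\<in>U i. \<forall>y\<in>U i. dist x y < (1/2)^n)) \<and>
      (\<forall>i j. \<forall>x\<in>U i \<inter> G. \<forall>y\<in>U j \<inter> G. i \<noteq> j \<longrightarrow> f x \<noteq> f y) \<and>
      (\<forall>T. closed T \<and> tight T \<longrightarrow> (\<exists>i. U i \<inter> T = {}))"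
    for V and n :: nat and U :: "nat \<Rightarrow> 'a set"
  \<comment> \<open>Choosing the splitting as a function of \<open>V\<close> and \<open>n\<close>
    lets the tree be defined by recursion.\<close>
  define S where "S V n = (SOME U. splits V n U)" for V n
  have S_splits: "splits V n (S V n)" if V: "open V" "V \<inter> M \<noteq> {}" for V n
    unfolding S_def
  proof (rule someI_ex[of "splits V n"])
    have "(1/2::real)^n > 0"
      by simp
    then show "\<exists>U. splits V n U"
    proof (rule splitting[OF V])
      fix U :: "nat \<Rightarrow> 'a set"
      assume "\<And>i. open (U i)" "\<And>i. U i \<inter> M \<noteq> {}" "\<And>i. closure (U i) \<subseteq> V"
        "\<And>i x y. x \<in> U i \<Longrightarrow> y \<in> U i \<Longrightarrow> dist x y < (1/2)^n"
        "\<And>i j x y. i \<noteq> j \<Longrightarrow> x \<in> U i \<inter> G \<Longrightarrow> y \<in> U j \<inter> G \<Longrightarrow> f x \<noteq> f y"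
        "\<And>T. closed T \<Longrightarrow> tight T \<Longrightarrow> \<exists>i. U i \<inter> T = {}"
      then have "splits V n U"
        unfolding splits_def by (intro conjI allI ballI impI) (assumption | simp)+
      then show "\<exists>U. splits V n U"
        by (rule exI[of "splits V n"])
    qed
  qed
  have S: "open (S V n i) \<and> S V n i \<inter> M \<noteq> {} \<and> closure (S V n i) \<subseteq> V \<and>
      (\<forall>x\<in>S V n i. \<forall>y\<in>S V n i. dist x y < (1/2)^n)" if "open V" "V \<inter> M \<noteq> {}" for V n i
    using S_splits[OF that, of n] by (simp add: splits_def)
  have S_sep: "f x \<noteq> f y"
    if "open V" "V \<inter> M \<noteq> {}" "x \<in> S V n i \<inter> G" "y \<in> S V n j \<inter> G" "i \<noteq> j" for V n i j x y
  proof -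
    have "\<forall>i j. \<forall>x\<in>S V n i \<inter> G. \<forall>y\<in>S V n j \<inter> G. i \<noteq> j \<longrightarrow> f x \<noteq> f y"
      using S_splits[OF that(1,2), of n] unfolding splits_def by (elim conjE)
    with that(3-5) show ?thesis
      by simp
  qed
  have S_avoid: "\<exists>i. S V n i \<inter> T = {}" if "open V" "V \<inter> M \<noteq> {}" "closed T" "tight T" for V n T
    using S_splits[OF that(1,2), of n] that(3,4) by (simp add: splits_def)
  \<comment> \<open>The head of a list is the latest choice. A node is cut down to
    \<open>W (length s)\<close> before it is split, so level \<open>n + 1\<close> lies inside
    \<open>W n\<close>.\<close>
  define U where "U = rec_list UNIV (\<lambda>i s V. S (V \<inter> W (length s)) (length s) i)"
  have U_Nil: "U [] = UNIV"
    and U_Cons: "U (i # s) = S (U s \<inter> W (length s)) (length s) i" for i s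
    by (simp_all add: U_def)
  have W_meets: "V \<inter> W n \<inter> M \<noteq> {}" if "open V" "V \<inter> M \<noteq> {}" for V n
    using dense_openD[OF G(2) that] by (auto simp: G_eq)
  have U: "open (U s) \<and> U s \<inter> M \<noteq> {}" for s
  proof (induction s)
    case Nil
    then show ?case using \<open>M \<noteq> {}\<close> by (simp add: U_Nil)
  next
    case (Cons i s)
    then show ?case
      using S[of "U s \<inter> W (length s)"] W W_meets by (simp add: U_Cons open_Int)
  qed
  have V: "open (U s \<inter> W (length s))" "U s \<inter> W (length s) \<inter> M \<noteq> {}" for s
    using U[of s] W W_meets by (simp_all add: open_Int)
  have U_closure: "closure (U (i # s)) \<subseteq> U s \<inter> W (length s)" for i s
    using S[OF V, of s] by (simp add: U_Cons)
  have U_subset: "U (i # s) \<subseteq> U s \<inter> W (length s)" for i s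
    using U_closure closure_subset by blast
  have U_dist: "dist x y < (1/2)^length s" if "x \<in> U (i # s)" "y \<in> U (i # s)" for i s x y
    using S[OF V, of s] that by (simp add: U_Cons)
  \<comment> \<open>Lists with equal tails are siblings, separated by construction; otherwise the
    parents are already separated and contain the children.\<close>
  have U_sep: "f x \<noteq> f y"
    if "length s = length t" "s \<noteq> t" "x \<in> U s \<inter> G" "y \<in> U t \<inter> G" for s t x y
    using that
  proof (induction s t rule: list_induct2)
    case (Cons i s j t)
    then show ?case
    proof (cases "s = t")
      case True
      then show ?thesis
        using Cons S_sep[OF V, of x s "length s" i y j] by (simp add: U_Cons)
    next
      case False
      then show ?thesis
        using Cons U_subset by blast
    qed
  qed simp
  \<comment> \<open>Taking unions level by level makes \<open>B\<close> visibly Borel, which a union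
    over uncountably many branches would not.\<close>
  define B where "B = M \<inter> (\<Inter>n. \<Union>s\<in>{s. length s = n}. U s)"
  have "B \<subseteq> G"
  proof
    fix x assume "x \<in> B"
    have "x \<in> W n" for n
    proof -
      obtain s where "length s = Suc n" "x \<in> U s"
        using \<open>x \<in> B\<close> by (auto simp: B_def)
      then show ?thesis
        using U_subset by (auto simp: length_Suc_conv)
    qed
    then show "x \<in> G"
      using \<open>x \<in> B\<close> by (simp add: B_def G_eq)
  qed
  show thesis
  proof
    have "open (\<Union>s\<in>{s. length s = n}. U s)" for n
      using U by blast
    moreover have "closed M"
      using compact_M by (rule compact_imp_closed)
    ultimately show "B \<in> sets borel"
      unfolding B_def by (intro sets.Int sets.countable_INT'') auto
    show "B \<subseteq> M"
      by (simp add: B_def)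
    show "inj_on f B"
    proof (rule inj_onI, rule ccontr)
      fix x y assume xy: "x \<in> B" "y \<in> B" "f x = f y" "x \<noteq> y"
      \<comment> \<open>Points of \<open>B\<close> with equal values share their node at every
        level. Level \<open>Suc n\<close> is used because \<open>U_dist\<close> bounds distances in
        a node by the length of its tail.\<close>
      then obtain n where n: "(1/2::real)^n < dist x y"
        using real_arch_pow_inv[of "dist x y" "1/2"] by auto
      obtain s where s: "length s = Suc n" "x \<in> U s"
        using xy(1) by (auto simp: B_def)
      obtain t where t: "length t = Suc n" "y \<in> U t"
        using xy(2) by (auto simp: B_def)
      have "s = t"
        using U_sep[of s t x y] s t xy \<open>B \<subseteq> G\<close> by auto
      then show False
        using s t n U_dist[of x "hd s" "tl s" y] by (cases s) auto
    qed
    show "\<not> sigma_tight B"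
    proof
      assume "sigma_tight B"
      then obtain T :: "nat \<Rightarrow> 'a set" where T: "\<And>n. closed (T n)" "\<And>n. tight (T n)"
        "B \<subseteq> (\<Union>n. T n)"
        by (erule sigma_tight_closedE)
      \<comment> \<open>Builds the branch: the child chosen at step \<open>n\<close> misses
        \<open>T n\<close>.\<close>
      have "\<exists>s. \<forall>n. length (s n) = n \<and> ((\<exists>i. s (Suc n) = i # s n) \<and> U (s (Suc n)) \<inter> T n = {})"
      proof (rule dependent_nat_choice)
        show "\<exists>t. length t = Suc n \<and> ((\<exists>i. t = i # s) \<and> U t \<inter> T n = {})"
          if "length s = n" for s n
        proof -
          obtain i where "U (i # s) \<inter> T n = {}"
            using S_avoid[OF V[of s] T(1,2)[of n], of "length s"] by (auto simp: U_Cons)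
          with that show ?thesis
            by (intro exI[of _ "i # s"]) simp
        qed
      qed simp
      then obtain s where s: "\<And>n. length (s n) = n" "\<And>n. \<exists>i. s (Suc n) = i # s n"
        "\<And>n. U (s (Suc n)) \<inter> T n = {}"
        by metis
      have decr: "closure (U (s (Suc n))) \<subseteq> U (s n)" for n
      proof -
        obtain i where "s (Suc n) = i # s n"
          using s(2) by blast
        with U_closure[of i "s n"] show ?thesis
          by simp
      qed
      have "U (s (Suc n)) \<subseteq> U (s n)" for n
        using decr closure_subset by blast
      then have mono: "U (s n) \<subseteq> U (s m)" if "m \<le> n" for m n
        using that by (rule lift_Suc_antimono_le)
      \<comment> \<open>Compactness gives a point in the closures only; \<open>decr\<close> then
        places it in the nodes themselves.\<close>
      have "M \<inter> (\<Inter>n\<in>UNIV. closure (U (s n))) \<noteq> {}"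
      proof (rule compact_imp_fip_image[OF compact_M])
        fix I :: "nat set" assume "finite I"
        then obtain N where N: "\<And>n. n \<in> I \<Longrightarrow> n \<le> N"
          using finite_nat_set_iff_bounded_le[of I] by auto
        have "U (s N) \<subseteq> (\<Inter>n\<in>I. closure (U (s n)))"
        proof (rule INT_greatest)
          show "U (s N) \<subseteq> closure (U (s n))" if "n \<in> I" for n
            using mono[OF N[OF that]] closure_subset[of "U (s n)"] by (rule subset_trans)
        qed
        then show "M \<inter> (\<Inter>n\<in>I. closure (U (s n))) \<noteq> {}"
          using U[of "s N"] by blast
      qed simp
      then obtain x where x: "x \<in> M" "\<And>n. x \<in> closure (U (s n))"
        by blast
      then have x_U: "x \<in> U (s n)" for n
        using decr by blast
      then have "x \<in> B"
        using x(1) s(1) by (auto simp: B_def)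
      then show False
        using T(3) s(3) x_U by blast
    qed
  qed
qed

end

theorem borel_constant_or_injective:
  fixes f :: "'a \<Rightarrow> real"
  assumes f: "f \<in> borel_measurable (restrict_space borel M)" "f ` M \<subseteq> {a..b}" and "M \<noteq> {}"
  obtains B where "B \<in> sets borel" "B \<subseteq> M" "\<not> sigma_tight B" "f constant_on B \<or> inj_on f B"
proof (cases "\<exists>t. \<not> sigma_tight {x\<in>M. f x = t}")
  case True
  then obtain t where t: "\<not> sigma_tight {x\<in>M. f x = t}"
    by blast
  have "closed M"
    using compact_M by (rule compact_imp_closed)
  then have "f -` {t} \<inter> M \<in> sets borel"
    using measurable_sets[OF f(1), of "{t}"]
    by (auto simp: sets_restrict_space_iff space_restrict_space)
  moreover have "f -` {t} \<inter> M = {x\<in>M. f x = t}"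
    by auto
  ultimately show thesis
    using that[of "{x\<in>M. f x = t}"] t by (auto simp: constant_on_def)
next
  case False
  obtain W :: "nat \<Rightarrow> 'a set" where W: "\<And>n. open (W n)" "\<And>n. M \<subseteq> closure (M \<inter> W n)"
    and cont: "continuous_on (M \<inter> (\<Inter>n. W n)) f"
    using borel_measurable_continuous_on_comeagre[OF compact_imp_closed[OF compact_M] f(1)] by blast
  \<comment> \<open>All fibres are \<open>\<sigma>\<close>-tight here. With
    \<open>G = M \<inter> (\<Inter>n. W n)\<close>, Baire category gives both the density of
    \<open>G\<close> and its failure to be \<open>\<sigma>\<close>-tight in any open set meeting
    \<open>M\<close>.\<close>
  show thesis
    using injective_set[OF _ compact_Baire[OF compact_M W] comeagre_not_sigma_tight[OF W] cont f(2) _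
        W(1) refl \<open>M \<noteq> {}\<close>] False that
    by blast
qed

end

section \<open>Measures on the rationals and their cutoff integrals\<close>

lemma continuous_map_measurable_borel_space:
  assumes "continuous_map X Y h"
  shows "h \<in> borel_space X \<rightarrow>\<^sub>M borel_space Y"
proof (rule measurable_sigma_sets)
  show "sets (borel_space Y) = sigma_sets (topspace Y) {U. openin Y U}"
    by (rule sets_borel_space)
  show "{U. openin Y U} \<subseteq> Pow (topspace Y)"
    by (auto dest: openin_subset)
  show "h \<in> space (borel_space X) \<rightarrow> topspace Y"
    using continuous_map_funspace[OF assms] by simp
  fix U assume "U \<in> {U. openin Y U}"
  then have "openin X {x \<in> topspace X. h x \<in> U}"
    using openin_continuous_map_preimage[OF assms] by simp
  moreover have "h -` U \<inter> space (borel_space X) = {x \<in> topspace X. h x \<in> U}"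
    by auto
  ultimately show "h -` U \<inter> space (borel_space X) \<in> sets (borel_space X)"
    by (simp add: sets_borel_space sigma_sets.Basic)
qed

text \<open>Every subset of the countable set \<open>\<rat>\<close> is Borel, so measurability on
  this space is automatic.\<close>

lemma prob_measures_rationals:
  assumes "\<mu> \<in> prob_measures rationals_space"
  shows "sets \<mu> = Pow \<rat>" "space \<mu> = \<rat>" "prob_space \<mu>"
proof -
  have "sets (restrict_space borel (\<rat>::real set)) = Pow \<rat>"
  proof -
    have countable_borel: "A \<in> sets borel" if "A \<subseteq> (\<rat>::real set)" for A
      by (rule sets.countable[OF _ countable_subset[OF that countable_rat]]) simp
    show ?thesis
      using countable_borel
      by (auto simp: sets_restrict_space_iff)
  qed
  then show "sets \<mu> = Pow \<rat>"
    using assms by (simp add: prob_measures_def sets_borel_space_top_of_set)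
  then show "space \<mu> = \<rat>"
    using sets.sets_into_space[of \<rat> \<mu>] sets.top[of \<mu>] by auto
  show "prob_space \<mu>"
    using assms by (simp add: prob_measures_def)
qed

text \<open>Lipschitz functions decreasing in \<open>k\<close> to the indicator of a nonempty closed
  \<open>F\<close>. For empty \<open>F\<close>, \<open>infdist\<close> is 0 and they are constantly
  1, so the limits below take \<open>F\<close> nonempty.\<close>

definition cutoff :: "'a::metric_space set \<Rightarrow> nat \<Rightarrow> 'a \<Rightarrow> real" where
  "cutoff F k x = max 0 (1 - real k * infdist x F)"

lemma cutoff_bounds [simp]: "0 \<le> cutoff F k x" "cutoff F k x \<le> 1" "\<bar>cutoff F k x\<bar> \<le> 1"
  by (simp_all add: cutoff_def infdist_nonneg)

lemma continuous_on_cutoff: "continuous_on S (cutoff F k)"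
  unfolding cutoff_def by (intro continuous_intros)

lemma cutoff_tendsto_indicator:
  assumes "closed F" "F \<noteq> {}"
  shows "(\<lambda>k. cutoff F k x) \<longlonglongrightarrow> indicator F x"
proof (cases "x \<in> F")
  case True
  then show ?thesis
    by (simp add: cutoff_def)
next
  case False
  then have "infdist x F > 0"
    using assms infdist_pos_not_in_closed by blast
  then obtain N where N: "1 < real N * infdist x F"
    using reals_Archimedean3 by blast
  have "cutoff F k x = 0" if "k \<ge> N" for k
  proof -
    have "real N * infdist x F \<le> real k * infdist x F"
      using that by (intro mult_right_mono) (auto simp: infdist_nonneg)
    then show ?thesis
      using N by (simp add: cutoff_def)
  qed
  then show ?thesis
    using False by (intro tendsto_eventually) (auto simp: eventually_sequentially)
qed

lemma integrable_cutoff: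
  assumes "\<mu> \<in> prob_measures rationals_space"
  shows "integrable \<mu> (cutoff F k)"
proof -
  interpret prob_space \<mu>
    using assms by (rule prob_measures_rationals)
  show ?thesis
    by (intro integrable_const_bound[where B = 1])
      (auto simp: measurable_def prob_measures_rationals[OF assms])
qed

lemma integral_cutoff_tendsto:
  assumes \<mu>: "\<mu> \<in> prob_measures rationals_space" and F: "closed F" "F \<noteq> {}"
  shows "(\<lambda>k. \<integral>x. cutoff F k x \<partial>\<mu>) \<longlonglongrightarrow> measure \<mu> (F \<inter> \<rat>)"
proof -
  interpret prob_space \<mu>
    using \<mu> by (rule prob_measures_rationals)
  have "(\<lambda>k. \<integral>x. cutoff F k x \<partial>\<mu>) \<longlonglongrightarrow> (\<integral>x. indicator F x \<partial>\<mu>)"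
    by (intro integral_dominated_convergence[where w = "\<lambda>_. 1"])
      (auto simp: measurable_def prob_measures_rationals[OF \<mu>] intro!: AE_I2 cutoff_tendsto_indicator F)
  then show ?thesis
    by (simp add: prob_measures_rationals[OF \<mu>])
qed

lemma measure_le_integral_cutoff:
  assumes \<mu>: "\<mu> \<in> prob_measures rationals_space"
  shows "measure \<mu> (F \<inter> \<rat>) \<le> (\<integral>x. cutoff F k x \<partial>\<mu>)"
proof -
  interpret prob_space \<mu>
    using \<mu> by (rule prob_measures_rationals)
  have "measure \<mu> (F \<inter> \<rat>) = (\<integral>x. indicator (F \<inter> \<rat>) x \<partial>\<mu>)"
    by (simp add: prob_measures_rationals[OF \<mu>] Int_assoc)
  also have "\<dots> \<le> (\<integral>x. cutoff F k x \<partial>\<mu>)"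
  proof (rule integral_mono)
    show "integrable \<mu> (indicator (F \<inter> \<rat>) :: real \<Rightarrow> real)"
      by (rule integrable_real_indicator) (auto simp: prob_measures_rationals[OF \<mu>] emeasure_eq_measure)
    show "indicator (F \<inter> \<rat>) x \<le> cutoff F k x" for x
      by (auto simp: indicator_def cutoff_def)
  qed (rule integrable_cutoff[OF \<mu>])
  finally show ?thesis .
qed

lemma continuous_map_weak_topology_integral:
  assumes "continuous_map X euclideanreal g" "bounded (g ` topspace X)"
  shows "continuous_map (weak_topology X) euclideanreal (\<lambda>\<mu>. \<integral>x. g x \<partial>\<mu>)"
  unfolding continuous_map_def
proof (intro conjI allI impI)
  fix U assume "openin euclideanreal U"
  then have "open U"
    by simp
  then show "openin (weak_topology X) {\<mu> \<in> topspace (weak_topology X). (\<integral>x. g x \<partial>\<mu>) \<in> U}"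
    unfolding topspace_weak_topology unfolding weak_topology_def
    by (intro topology_generated_by_Basis CollectI exI[of _ g] exI[of _ U] conjI refl assms \<open>open U\<close>)
qed simp

lemma continuous_map_integral_cutoff:
  "continuous_map (weak_topology rationals_space) euclideanreal (\<lambda>\<mu>. \<integral>x. cutoff F k x \<partial>\<mu>)"
proof (rule continuous_map_weak_topology_integral)
  show "continuous_map rationals_space euclideanreal (cutoff F k)"
    by (simp add: continuous_on_cutoff)
  show "bounded (cutoff F k ` topspace rationals_space)"
    by (intro boundedI[of _ 1]) auto
qed

section \<open>A metrizable embedding\<close>

text \<open>\<open>n\<close> encodes a rational and a slope, so countably many coordinates map
  measures into \<open>nat \<Rightarrow> real\<close>, a metric space with a countable base.\<close>

definition tent_integrals :: "real measure \<Rightarrow> nat \<Rightarrow> real" where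
  "tent_integrals \<mu> n =
    (\<integral>x. cutoff {from_nat_into \<rat> (fst (prod_decode n))} (snd (prod_decode n)) x \<partial>\<mu>)"

lemma continuous_map_tent_integrals:
  "continuous_map (weak_topology rationals_space) euclidean tent_integrals"
  unfolding euclidean_product_topology[symmetric] continuous_map_componentwise_UNIV tent_integrals_def
  by (intro allI continuous_map_integral_cutoff)

text \<open>As the slope grows, the integrals converge to the point masses, and these determine a
  measure on a countable set.\<close>

lemma inj_on_tent_integrals: "inj_on tent_integrals (prob_measures rationals_space)"
proof (rule inj_onI)
  fix \<mu> \<nu>
  assume \<mu>: "\<mu> \<in> prob_measures rationals_space" and \<nu>: "\<nu> \<in> prob_measures rationals_space"
    and eq: "tent_integrals \<mu> = tent_integrals \<nu>"
  have "measure \<mu> {q} = measure \<nu> {q}" if q: "q \<in> \<rat>" for q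
  proof -
    obtain m where m: "from_nat_into \<rat> m = q"
      using from_nat_into_surj[OF countable_rat q] by blast
    have "(\<integral>x. cutoff {q} k x \<partial>\<mu>) = (\<integral>x. cutoff {q} k x \<partial>\<nu>)" for k
      using fun_cong[OF eq, of "prod_encode (m, k)"] by (simp add: tent_integrals_def m)
    then show ?thesis
      using integral_cutoff_tendsto[OF \<mu>, of "{q}"] integral_cutoff_tendsto[OF \<nu>, of "{q}"] q
      by (simp add: LIMSEQ_unique)
  qed
  moreover have "finite_measure \<mu>" "finite_measure \<nu>"
    using \<mu> \<nu> by (auto simp: prob_measures_rationals prob_space.finite_measure)
  ultimately show "\<mu> = \<nu>"
    using \<mu> \<nu> by (intro measure_eqI_countable[where A = \<rat>])
      (auto simp: prob_measures_rationals finite_measure.emeasure_eq_measure countable_rat)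
qed

section \<open>Uniform tightness and weak closure\<close>

text \<open>The cutoff integrals dominate the mass of \<open>D\<close> and converge to it, so this
  mass is at least \<open>1 - e\<close> iff all of them are; each of these conditions is closed in
  the weak topology.\<close>

lemma closedin_tight_bound:
  assumes "compactin rationals_space C"
  obtains D where "compactin rationals_space D" "C \<subseteq> D"
    "closedin (weak_topology rationals_space)
      {\<mu> \<in> prob_measures rationals_space. measure \<mu> (\<rat> - D) \<le> e}"
proof -
  \<comment> \<open>\<open>C\<close> may be empty; adding \<open>0\<close> gives the nonempty set
    that the cutoff limits require.\<close>
  define D where "D = insert 0 C"
  have D: "compact D" "D \<subseteq> \<rat>" "D \<noteq> {}"
    using assms by (auto simp: D_def compactin_subtopology)
  have "{\<mu> \<in> prob_measures rationals_space. measure \<mu> (\<rat> - D) \<le> e} =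
    (\<Inter>k. {\<mu> \<in> topspace (weak_topology rationals_space). (\<integral>x. cutoff D k x \<partial>\<mu>) \<in> {1 - e..}})"
  proof (intro set_eqI)
    fix \<mu>
    show "\<mu> \<in> {\<mu> \<in> prob_measures rationals_space. measure \<mu> (\<rat> - D) \<le> e} \<longleftrightarrow> \<mu> \<in>
      (\<Inter>k. {\<mu> \<in> topspace (weak_topology rationals_space). (\<integral>x. cutoff D k x \<partial>\<mu>) \<in> {1 - e..}})"
    proof (cases "\<mu> \<in> prob_measures rationals_space")
      case \<mu>: True
      interpret prob_space \<mu>
        using \<mu> by (rule prob_measures_rationals)
      have "measure \<mu> (\<rat> - D) = 1 - measure \<mu> (D \<inter> \<rat>)"
        using prob_compl[of "D \<inter> \<rat>"] D(2) by (simp add: prob_measures_rationals[OF \<mu>] Int_absorb2)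
      moreover have "(\<forall>k. 1 - e \<le> (\<integral>x. cutoff D k x \<partial>\<mu>)) \<longleftrightarrow> 1 - e \<le> measure \<mu> (D \<inter> \<rat>)"
        using measure_le_integral_cutoff[OF \<mu>, of D] D
          LIMSEQ_le_const[OF integral_cutoff_tendsto[OF \<mu> compact_imp_closed[OF D(1)] D(3)], of "1 - e"]
        by (meson order_trans)
      ultimately show ?thesis
        using \<mu> by auto
    qed auto
  qed
  moreover have "closedin (weak_topology rationals_space) \<dots>"
    by (intro closedin_INT closedin_continuous_map_preimage[OF continuous_map_integral_cutoff])
      auto
  ultimately show thesis
    using that[of D] D by (simp add: compactin_subtopology D_def subset_insertI)
qed

lemma uniformly_tight_subset: "uniformly_tight X T \<Longrightarrow> S \<subseteq> T \<Longrightarrow> uniformly_tight X S"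
  unfolding uniformly_tight_def by (meson subset_eq)

text \<open>A non-strict bound by \<open>e / 2\<close> is a closed condition and passes to the
  closure; halving \<open>e\<close> restores the strict inequality.\<close>

lemma uniformly_tight_closure_of:
  assumes "uniformly_tight rationals_space A"
  shows "uniformly_tight rationals_space (weak_topology rationals_space closure_of A)"
  unfolding uniformly_tight_def
proof (intro conjI allI impI)
  show "weak_topology rationals_space closure_of A \<subseteq> prob_measures rationals_space"
    using closure_of_subset_topspace[of "weak_topology rationals_space" A] by simp
  fix e :: real assume "e > 0"
  have "\<forall>\<epsilon>>0. \<exists>C. compactin rationals_space C \<and> (\<forall>\<mu>\<in>A. measure \<mu> (\<rat> - C) < \<epsilon>)"
    using assms by (simp add: uniformly_tight_def)
  from this[rule_format, of "e / 2"] \<open>e > 0\<close>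
  obtain C where C: "compactin rationals_space C" "\<forall>\<mu>\<in>A. measure \<mu> (\<rat> - C) < e / 2"
    by auto
  obtain D where D: "compactin rationals_space D" "C \<subseteq> D"
    and closed: "closedin (weak_topology rationals_space)
      {\<mu> \<in> prob_measures rationals_space. measure \<mu> (\<rat> - D) \<le> e / 2}"
    using closedin_tight_bound[OF C(1)] by blast
  have "measure \<mu> (\<rat> - D) \<le> e / 2" if "\<mu> \<in> A" for \<mu>
  proof -
    have \<mu>: "\<mu> \<in> prob_measures rationals_space"
      using assms that by (auto simp: uniformly_tight_def)
    interpret prob_space \<mu>
      using \<mu> by (rule prob_measures_rationals)
    have "measure \<mu> (\<rat> - D) \<le> measure \<mu> (\<rat> - C)"
      using D(2) by (intro finite_measure_mono) (auto simp: prob_measures_rationals[OF \<mu>])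
    then show ?thesis
      using C(2) that by fastforce
  qed
  then have "A \<subseteq> {\<mu> \<in> prob_measures rationals_space. measure \<mu> (\<rat> - D) \<le> e / 2}"
    using assms by (auto simp: uniformly_tight_def)
  from closure_of_minimal[OF this closed]
  have "\<forall>\<mu>\<in>weak_topology rationals_space closure_of A. measure \<mu> (\<rat> - D) < e"
    using \<open>e > 0\<close> by fastforce
  then show "\<exists>C. compactin rationals_space C \<and> (\<forall>\<mu>\<in>weak_topology rationals_space closure_of A.
      measure \<mu> (topspace rationals_space - C) < e)"
    using D(1) by auto
qed

section \<open>Transfer to the compact set of measures\<close>

theorem mainTheorem4:
  fixes K :: "real measure set" and f :: "real measure \<Rightarrow> real"
  assumes K_compact: "compactin (weak_topology rationals_space) K"
    and K_nonempty: "K \<noteq> {}"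
    and supp_locally_compact:
      "\<And>\<mu>. \<mu> \<in> K \<Longrightarrow> locally_compact_space (subtopology rationals_space (supp \<mu>))"
    and supp_almost_disjoint:
      "\<And>\<mu> \<nu>. \<mu> \<in> K \<Longrightarrow> \<nu> \<in> K \<Longrightarrow> \<mu> \<noteq> \<nu> \<Longrightarrow> finite (supp \<mu> \<inter> supp \<nu>)"
    and nowhere_tight:
      "\<And>V. openin (subtopology (weak_topology rationals_space) K) V \<Longrightarrow> V \<noteq> {} \<Longrightarrow>
         \<exists>L\<subseteq>V. compactin (weak_topology rationals_space) L \<and>
           (\<forall>A\<subseteq>K. sigma_uniformly_tight rationals_space A \<longrightarrow>
              (\<exists>C\<subseteq>L - A. compactin (weak_topology rationals_space) C \<and>
                 \<not> uniformly_tight rationals_space C))"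
    and f_borel:
      "f \<in> borel_space (subtopology (weak_topology rationals_space) K) \<rightarrow>\<^sub>M
         restrict_space borel {0..1}"
  shows "\<exists>B \<in> sets (borel_space (subtopology (weak_topology rationals_space) K)).
           \<not> sigma_uniformly_tight rationals_space B \<and> (f constant_on B \<or> inj_on f B)"
proof -
  let ?W = "weak_topology rationals_space"
  let ?X = "subtopology ?W K"
  let ?M = "tent_integrals ` K"
  \<comment> \<open>Sets off the image have empty preimage. Requiring
    \<open>S \<subseteq> ?M\<close> excludes them, as their closures could meet \<open>?M\<close> in
    a set that is not tight.\<close>
  define tight where "tight S \<longleftrightarrow> S \<subseteq> ?M \<and> uniformly_tight rationals_space {\<mu>\<in>K. tent_integrals \<mu> \<in> S}" for S
  have K: "K \<subseteq> prob_measures rationals_space"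
    using compactin_subset_topspace[OF K_compact] by simp
  have inj: "inj_on tent_integrals K"
    using inj_on_tent_integrals K by (rule inj_on_subset)
  have X: "topspace ?X = K" "compact_space ?X"
    using K K_compact by (auto simp: compact_space_subtopology)
  have cont: "continuous_map ?X (top_of_set ?M) tent_integrals"
    using continuous_map_from_subtopology[OF continuous_map_tent_integrals, of K] X(1)
    by (auto simp: continuous_map_in_subtopology)
  \<comment> \<open>A continuous injection from a compact space into a Hausdorff space is a
    homeomorphism onto its image, so \<open>K\<close> is metrizable.\<close>
  have hom: "homeomorphic_map ?X (top_of_set ?M) tent_integrals"
    using cont X inj by (intro continuous_imp_homeomorphic_map) (auto simp: Hausdorff_space_subtopology)
  then obtain g where g: "homeomorphic_maps ?X (top_of_set ?M) tent_integrals g"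
    by (auto simp: homeomorphic_map_maps)
  then have g_cont: "continuous_map (top_of_set ?M) ?X g"
    and g_inv: "\<And>\<mu>. \<mu> \<in> K \<Longrightarrow> g (tent_integrals \<mu>) = \<mu>"
    using X(1) by (auto simp: homeomorphic_maps_def)
  have vimage: "{\<mu>\<in>K. tent_integrals \<mu> \<in> tent_integrals ` S} = S" if "S \<subseteq> K" for S
    using that inj by (auto simp: inj_on_def)
  have image_compact: "compact (tent_integrals ` S)" if "compactin ?W S" for S
    using image_compactin[OF that continuous_map_tent_integrals] by simp
  have "compact ?M"
    using K_compact by (rule image_compact)
  interpret rich_tightness ?M tight
  proof
    show "compact ?M" by fact
    show "tight {}"
      by (auto simp: tight_def uniformly_tight_def intro!: exI[of _ "{}"])
    show "tight S" if "tight T" "S \<subseteq> T" for S T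
    proof -
      have "uniformly_tight rationals_space {\<mu>\<in>K. tent_integrals \<mu> \<in> T}"
        using that(1) by (simp add: tight_def)
      then have "uniformly_tight rationals_space {\<mu>\<in>K. tent_integrals \<mu> \<in> S}"
        by (rule uniformly_tight_subset) (use that(2) in auto)
      with that show ?thesis
        by (auto simp: tight_def)
    qed
    show "tight (closure T)" if "tight T" for T
    proof -
      let ?A = "{\<mu>\<in>K. tent_integrals \<mu> \<in> T}"
      have A: "?A \<subseteq> topspace ?X" "tent_integrals ` ?A = T"
        using that X(1) by (auto simp: tight_def)
      have "closure T \<subseteq> ?M"
        using that \<open>compact ?M\<close> by (simp add: tight_def closure_minimal compact_imp_closed)
      \<comment> \<open>The homeomorphism carries closure in \<open>K\<close> to closure in
        \<open>?M\<close>; the former lies in the weak closure, where tightness persists.\<close>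
      moreover have "closure T = tent_integrals ` (?X closure_of ?A)"
        using homeomorphic_map_closure_of[OF hom A(1)] A(2) \<open>closure T \<subseteq> ?M\<close> that
        by (simp add: closure_of_subtopology tight_def Int_absorb1)
      moreover have "?X closure_of ?A \<subseteq> K \<inter> ?W closure_of ?A"
        using closure_of_subset_topspace[of ?X ?A] X(1) closure_of_subtopology_subset[of ?W K ?A]
        by blast
      ultimately have "{\<mu>\<in>K. tent_integrals \<mu> \<in> closure T} \<subseteq> ?W closure_of ?A"
        using vimage[of "?X closure_of ?A"] by simp
      moreover have "uniformly_tight rationals_space (?W closure_of ?A)"
        using that by (intro uniformly_tight_closure_of) (simp add: tight_def)
      ultimately show ?thesis
        using uniformly_tight_subset \<open>closure T \<subseteq> ?M\<close> by (simp add: tight_def)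
    qed
    fix V :: "(nat \<Rightarrow> real) set" assume V: "open V" "V \<inter> ?M \<noteq> {}"
    define V' where "V' = {\<mu>\<in>K. tent_integrals \<mu> \<in> V}"
    have "openin ?X {\<mu> \<in> topspace ?X. tent_integrals \<mu> \<in> ?M \<inter> V}"
      using openin_continuous_map_preimage[OF cont openin_open_Int[OF V(1)]] .
    moreover have "{\<mu> \<in> topspace ?X. tent_integrals \<mu> \<in> ?M \<inter> V} = V'"
      unfolding V'_def X(1) by blast
    moreover have "V' \<noteq> {}"
      using V(2) by (auto simp: V'_def)
    ultimately have "openin ?X V'" "V' \<noteq> {}"
      by simp_all
    then obtain L where L: "L \<subseteq> V'" "compactin ?W L"
      "\<forall>A\<subseteq>K. sigma_uniformly_tight rationals_space A \<longrightarrow>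
         (\<exists>C\<subseteq>L - A. compactin ?W C \<and> \<not> uniformly_tight rationals_space C)"
      using nowhere_tight by metis
    have "L \<subseteq> K"
      using L(1) X(1) by (auto simp: V'_def)
    show "\<exists>L\<subseteq>V \<inter> ?M. compact L \<and> (\<forall>T. (\<forall>n::nat. tight (T n)) \<longrightarrow>
        (\<exists>C\<subseteq>L - (\<Union>n. T n). compact C \<and> \<not> tight C))"
    proof (rule exI[of _ "tent_integrals ` L"], intro conjI allI impI)
      show "tent_integrals ` L \<subseteq> V \<inter> ?M"
        using L(1) X(1) by (auto simp: V'_def)
      show "compact (tent_integrals ` L)"
        using L(2) by (rule image_compact)
      fix T :: "nat \<Rightarrow> (nat \<Rightarrow> real) set" assume T: "\<forall>n. tight (T n)"
      \<comment> \<open>Pulls the sequence back to a single \<open>\<sigma>\<close>-uniformly tight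
        subset of \<open>K\<close>, to which hypothesis (ii) applies.\<close>
      define A where "A = (\<Union>n. {\<mu>\<in>K. tent_integrals \<mu> \<in> T n})"
      have "sigma_uniformly_tight rationals_space A"
        unfolding sigma_uniformly_tight_def A_def
        using T by (intro exI[of _ "range (\<lambda>n. {\<mu>\<in>K. tent_integrals \<mu> \<in> T n})"]) (auto simp: tight_def)
      moreover have "A \<subseteq> K"
        by (auto simp: A_def)
      ultimately obtain C where C: "C \<subseteq> L - A" "compactin ?W C" "\<not> uniformly_tight rationals_space C"
        using L(3) by blast
      have "C \<subseteq> K"
        using C(1) \<open>L \<subseteq> K\<close> by blast
      show "\<exists>C\<subseteq>tent_integrals ` L - (\<Union>n. T n). compact C \<and> \<not> tight C"
      proof (intro exI[of _ "tent_integrals ` C"] conjI)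
        show "tent_integrals ` C \<subseteq> tent_integrals ` L - (\<Union>n. T n)"
          using C(1) \<open>C \<subseteq> K\<close> by (auto simp: A_def)
        show "compact (tent_integrals ` C)"
          using C(2) by (rule image_compact)
        show "\<not> tight (tent_integrals ` C)"
          using C(3) \<open>C \<subseteq> K\<close> by (auto simp: tight_def vimage)
      qed
    qed
  qed
  \<comment> \<open>Needed in contrapositive form, to carry the failure of
    \<open>\<sigma>\<close>-tightness from the image back to the measures.\<close>
  have sigma: "sigma_tight B"
    if tight_B: "sigma_uniformly_tight rationals_space {\<mu>\<in>K. tent_integrals \<mu> \<in> B}"
      and "B \<subseteq> ?M" for B
  proof -
    obtain \<T> where \<T>: "countable \<T>" "\<forall>T\<in>\<T>. uniformly_tight rationals_space T"
      "{\<mu>\<in>K. tent_integrals \<mu> \<in> B} \<subseteq> \<Union>\<T>"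
      using tight_B unfolding sigma_uniformly_tight_def by blast
    \<comment> \<open>\<open>\<T>\<close> may be empty; the added empty set is tight and makes an
      enumeration possible.\<close>
    define T where "T = from_nat_into (insert {} \<T>)"
    have T: "range T = insert {} \<T>"
      using \<T>(1) by (simp add: T_def range_from_nat_into)
    have "tight (tent_integrals ` (T n \<inter> K))" for n
    proof -
      have "uniformly_tight rationals_space (T n)"
      proof (cases "T n = {}")
        case False
        then show ?thesis
          using \<T>(2) T rangeI[of T n] by simp
      qed (auto simp: uniformly_tight_def intro!: exI[of _ "{}"])
      then show ?thesis
        using uniformly_tight_subset[of _ "T n" "T n \<inter> K"] by (auto simp: tight_def vimage)
    qed
    moreover have "B \<subseteq> (\<Union>n. tent_integrals ` (T n \<inter> K))"
    proof
      fix y assume "y \<in> B"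
      then obtain \<mu> where \<mu>: "\<mu> \<in> K" "y = tent_integrals \<mu>"
        using \<open>B \<subseteq> ?M\<close> by blast
      then have "\<mu> \<in> \<Union>\<T>"
        using \<T>(3) \<open>y \<in> B\<close> by blast
      then obtain n where "\<mu> \<in> T n"
        using T by (metis UnionE insertI2 rangeE)
      then show "y \<in> (\<Union>n. tent_integrals ` (T n \<inter> K))"
        using \<mu> by blast
    qed
    ultimately show ?thesis
      unfolding sigma_tight_def by (intro exI[of _ "\<lambda>n. tent_integrals ` (T n \<inter> K)"]) simp
  qed
  have f: "f \<in> borel_measurable (borel_space ?X)" "f \<in> K \<rightarrow> {0..1}"
    using f_borel X(1) by (auto simp: measurable_restrict_space2_iff)
  have "f \<circ> g \<in> borel_measurable (borel_space (top_of_set ?M))"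
    using continuous_map_measurable_borel_space[OF g_cont] f(1) by (rule measurable_comp)
  \<comment> \<open>The Borel sets generated by the relatively open subsets of \<open>?M\<close> are
    those inherited from \<open>nat \<Rightarrow> real\<close>, so the abstract theorem applies to
    \<open>f \<circ> g\<close>.\<close>
  then have fg: "f \<circ> g \<in> borel_measurable (restrict_space borel ?M)"
    by (simp cong: measurable_cong_sets add: sets_borel_space_top_of_set)
  have "(f \<circ> g) ` ?M \<subseteq> {0..1}"
    using f(2) g_inv by auto
  from borel_constant_or_injective[OF fg this] K_nonempty
  obtain B where B: "B \<in> sets borel" "B \<subseteq> ?M" "\<not> sigma_tight B"
    "(f \<circ> g) constant_on B \<or> inj_on (f \<circ> g) B"
    by blast
  define B' where "B' = {\<mu>\<in>K. tent_integrals \<mu> \<in> B}"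
  have "tent_integrals ` B' \<subseteq> B" "B' \<subseteq> K"
    by (auto simp: B'_def)
  show ?thesis
  proof (intro bexI[of _ B'] conjI)
    show "\<not> sigma_uniformly_tight rationals_space B'"
      using B(2,3) sigma unfolding B'_def by blast
    show "f constant_on B' \<or> inj_on f B'"
      using B(4)
    proof
      assume "(f \<circ> g) constant_on B"
      then obtain c where "\<And>y. y \<in> B \<Longrightarrow> f (g y) = c"
        by (auto simp: constant_on_def)
      then have "f \<mu> = c" if "\<mu> \<in> B'" for \<mu>
        using that g_inv by (fastforce simp: B'_def)
      then show ?thesis
        unfolding constant_on_def by blast
    next
      assume inj_B: "inj_on (f \<circ> g) B"
      have "inj_on f B'"
      proof (rule inj_onI)
        fix \<mu> \<nu> assume *: "\<mu> \<in> B'" "\<nu> \<in> B'" "f \<mu> = f \<nu>"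
        then have "tent_integrals \<mu> = tent_integrals \<nu>"
          using g_inv by (intro inj_onD[OF inj_B]) (auto simp: B'_def)
        then show "\<mu> = \<nu>"
          using * inj by (auto simp: B'_def inj_on_def)
      qed
      then show ?thesis ..
    qed
    have "tent_integrals \<in> borel_space ?X \<rightarrow>\<^sub>M borel_space (top_of_set ?M)"
      using cont by (rule continuous_map_measurable_borel_space)
    moreover have "B \<in> sets (borel_space (top_of_set ?M))"
      using B(1,2) borel_compact[OF \<open>compact ?M\<close>]
      by (simp add: sets_borel_space_top_of_set sets_restrict_space_iff)
    ultimately have "tent_integrals -` B \<inter> space (borel_space ?X) \<in> sets (borel_space ?X)"
      by (rule measurable_sets)
    moreover have "tent_integrals -` B \<inter> space (borel_space ?X) = B'"
      using X(1) by (auto simp: B'_def)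
    ultimately show "B' \<in> sets (borel_space ?X)"
      by simp
  qed
qed

end
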